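(* Let $G=G(\mathsf{x};\bar\lambda,\lambda,\bar\rho,\rho)$ be the generating function of labeled plane binary trees by left ascents, left descents, right ascents and right descents, and let $H(z)=\sum_{n\ge 0}h_nz^n$, where $h_n$ is the $n$th complete homogeneous symmetric function in $\mathsf{x}=\{x_1,x_2,\dots\}$. Then $$\frac{(1+\bar\lambda G)(1+\bar\rho G)}{(1+\lambda G)(1+\rho G)}=H\bigl((\bar\lambda\bar\rho-\lambda\rho)G+\bar\lambda+\bar\rho-\lambda-\rho\bigr).$$
   Context: A (plane binary) tree is a rooted tree in which every node has at most one left child and at most one right child (it may have only one of the two), and no other children. A labeled tree is a tree whose nodes are labeled with positive integers, repetitions allowed; $\mathcal{T}^{\ell}_n$ is the set of labeled trees on $n\ge 1$ nodes. Write $v^\ell$ for the label of a node $v$. If $v$ is the left child of $w$, the edge between them is a left ascent if $v^\ell\le w^\ell$ and a left descent otherwise. If $w$ is the right child of $v$, the edge between them is a right ascent if $v^\ell\le w^\ell$ and a right descent otherwise. Let $\mathrm{lasc}(T),\mathrm{ldes}(T),\mathrm{rasc}(T),\mathrm{rdes}(T)$ be the numbers of left ascents, left descents, right ascents and right descents of $T$. Let $\mathsf{x}=\{x_1,x_2,\dots\}$ be commuting indeterminates, $\mathsf{x}^T=\prod_{v\in T}x_{v^\ell}$, and let $\bar\lambda,\lambda,\bar\rho,\rho$ be commuting indeterminates. Define the formal power series in $\mathsf{x}$ with coefficients in $\mathbb{Q}[\bar\lambda,\lambda,\bar\rho,\rho]$ $$G=\sum_{n\ge 1}\sum_{T\in\mathcal{T}^\ell_n}\bar\lambda^{\mathrm{lasc}(T)}\lambda^{\mathrm{ldes}(T)}\bar\rho^{\,\mathrm{rasc}(T)}\rho^{\,\mathrm{rdes}(T)}\,\mathsf{x}^T.$$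 *)

theory Defs
  imports Complex_Main "HOL-Library.Tree_Multiset" "HOL-Library.Poly_Mapping"
begin

section \<open>Formal power series in arbitrarily many commuting indeterminates\<close>

text \<open>
  Monomials in indeterminates indexed by \<open>'v\<close> are multisets over \<open>'v\<close>, so that the product of
  monomials is the union of multisets; a power series is an arbitrary function from monomials
  to coefficients.
\<close>

typedef ('v, 'a) mps = "UNIV :: ('v multiset \<Rightarrow> 'a) set"
  morphisms mps_coeff Abs_mps ..

setup_lifting type_definition_mps

lemma mps_eqI: "(\<And>m. mps_coeff f m = mps_coeff g m) \<Longrightarrow> f = g"
  by (simp add: mps_coeff_inject[symmetric] fun_eq_iff)

lemma splits_add_mset:
  "{(a, b). a + b = add_mset x m} =
     (\<lambda>(a, b). (add_mset x a, b)) ` {(a, b). a + b = m} \<union>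
     (\<lambda>(a, b). (a, add_mset x b)) ` {(a, b). a + b = m}"
proof (intro set_eqI iffI)
  fix p assume "p \<in> {(a, b). a + b = add_mset x m}"
  then obtain a b where p: "p = (a, b)" and ab: "a + b = add_mset x m" by auto
  then have "x \<in># a + b" by simp
  then consider a' where "a = add_mset x a'" | b' where "b = add_mset x b'"
    by (auto dest: multi_member_split)
  then show "p \<in> (\<lambda>(a, b). (add_mset x a, b)) ` {(a, b). a + b = m} \<union>
     (\<lambda>(a, b). (a, add_mset x b)) ` {(a, b). a + b = m}"
  proof cases
    case 1
    then show ?thesis using p ab by (intro UnI1 image_eqI[where x = "(a', b)"]) auto
  next
    case 2
    then show ?thesis using p ab by (intro UnI2 image_eqI[where x = "(a, b')"]) auto
  qed
qed auto

lemma finite_splits [simp, intro]: "finite {(a, b). a + b = (m :: 'v multiset)}"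
proof (induction m)
  case empty
  have "{(a, b). a + b = ({#} :: 'v multiset)} = {({#}, {#})}" by auto
  then show ?case by simp
next
  case (add x m)
  then show ?case by (simp only: splits_add_mset) simp
qed

instantiation mps :: (type, comm_ring_1) comm_ring_1
begin

lift_definition zero_mps :: "('a, 'b) mps" is "\<lambda>m. 0" .
lift_definition one_mps :: "('a, 'b) mps" is "\<lambda>m. if m = {#} then 1 else 0" .
lift_definition plus_mps :: "('a, 'b) mps \<Rightarrow> ('a, 'b) mps \<Rightarrow> ('a, 'b) mps"
  is "\<lambda>f g m. f m + g m" .
lift_definition minus_mps :: "('a, 'b) mps \<Rightarrow> ('a, 'b) mps \<Rightarrow> ('a, 'b) mps"
  is "\<lambda>f g m. f m - g m" .
lift_definition uminus_mps :: "('a, 'b) mps \<Rightarrow> ('a, 'b) mps"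
  is "\<lambda>f m. - f m" .
lift_definition times_mps :: "('a, 'b) mps \<Rightarrow> ('a, 'b) mps \<Rightarrow> ('a, 'b) mps"
  is "\<lambda>f g m. \<Sum>(a, b) \<in> {(a, b). a + b = m}. f a * g b" .

instance
proof
  fix f g h :: "('a, 'b) mps"
  show "f * g = g * f"
  proof (transfer, rule ext)
    fix f g :: "'a multiset \<Rightarrow> 'b" and m
    show "(\<Sum>(a, b) \<in> {(a, b). a + b = m}. f a * g b) =
          (\<Sum>(a, b) \<in> {(a, b). a + b = m}. g a * f b)"
      by (rule sum.reindex_bij_witness[where i = prod.swap and j = prod.swap])
         (auto simp: ac_simps)
  qed
  show "f * g * h = f * (g * h)"
  proof (transfer, rule ext)
    fix f g h :: "'a multiset \<Rightarrow> 'b" and m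
    let ?S = "\<lambda>m. {(a, b). a + b = (m :: 'a multiset)}"
    have "(\<Sum>(c, d) \<in> ?S m. (\<Sum>(a, b) \<in> ?S c. f a * g b) * h d) =
          (\<Sum>p \<in> ?S m. \<Sum>q \<in> ?S (fst p). f (fst q) * g (snd q) * h (snd p))"
      by (simp add: sum_distrib_right case_prod_unfold)
    also have "\<dots> = (\<Sum>(p, q) \<in> (SIGMA p:?S m. ?S (fst p)). f (fst q) * g (snd q) * h (snd p))"
      by (subst sum.Sigma) auto
    also have "\<dots> = (\<Sum>(p, q) \<in> (SIGMA p:?S m. ?S (snd p)). f (fst p) * (g (fst q) * h (snd q)))"
      by (rule sum.reindex_bij_witness[where
            i = "\<lambda>((a, e), (b, d)). ((a + b, d), (a, b))" and
            j = "\<lambda>((c, d), (a, b)). ((a, b + d), (b, d))"])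
         (auto simp: ac_simps)
    also have "\<dots> = (\<Sum>p \<in> ?S m. \<Sum>q \<in> ?S (snd p). f (fst p) * (g (fst q) * h (snd q)))"
      by (subst sum.Sigma) auto
    also have "\<dots> = (\<Sum>(a, e) \<in> ?S m. f a * (\<Sum>(b, d) \<in> ?S e. g b * h d))"
      by (simp add: sum_distrib_left case_prod_unfold)
    finally show "(\<Sum>(c, d) \<in> ?S m. (\<Sum>(a, b) \<in> ?S c. f a * g b) * h d) =
      (\<Sum>(a, e) \<in> ?S m. f a * (\<Sum>(b, d) \<in> ?S e. g b * h d))" .
  qed
  show "1 * f = f"
  proof (transfer, rule ext)
    fix f :: "'a multiset \<Rightarrow> 'b" and m
    have "(\<Sum>(a, b) \<in> {(a, b). a + b = m}. (if a = {#} then 1 else 0) * f b) =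
          (\<Sum>(a, b) \<in> {({#} :: 'a multiset, m)}. (if a = {#} then 1 else 0) * f b)"
      by (rule sum.mono_neutral_right) (auto split: if_splits)
    then show "(\<Sum>(a, b) \<in> {(a, b). a + b = m}. (if a = {#} then 1 else 0) * f b) = f m"
      by simp
  qed
  show "(f + g) * h = f * h + g * h"
    by transfer (auto simp: fun_eq_iff case_prod_unfold algebra_simps sum.distrib)
  show "(0 :: ('a, 'b) mps) \<noteq> 1"
    by transfer (auto simp: fun_eq_iff)
qed (transfer; simp add: fun_eq_iff algebra_simps)+

end

lift_definition mps_const :: "'a :: zero \<Rightarrow> ('v, 'a) mps"
  is "\<lambda>c m. if m = {#} then c else 0" .

lift_definition mps_monom :: "'v multiset \<Rightarrow> ('v, 'a :: zero_neq_one) mps"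
  is "\<lambda>M m. if m = M then 1 else 0" .

text \<open>
  Infinite sums of power series are taken coefficientwise. The value is meaningful only if every
  monomial has a nonzero coefficient in finitely many summands, i.e. for a locally finite family;
  this is proved below for both sums that are used.
\<close>

definition locally_finite :: "'i set \<Rightarrow> ('i \<Rightarrow> ('v, 'a :: zero) mps) \<Rightarrow> bool" where
  "locally_finite I f \<longleftrightarrow> (\<forall>m. finite {i \<in> I. mps_coeff (f i) m \<noteq> 0})"

definition formal_sum :: "'i set \<Rightarrow> ('i \<Rightarrow> ('v, 'a :: comm_monoid_add) mps) \<Rightarrow> ('v, 'a) mps" where
  "formal_sum I f = Abs_mps (\<lambda>m. \<Sum>i \<in> {i \<in> I. mps_coeff (f i) m \<noteq> 0}. mps_coeff (f i) m)"

text \<open>The inverse of a non-unit is 0 by convention, as for division by 0 in a field.\<close>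

instantiation mps :: (type, comm_ring_1) inverse
begin

definition inverse_mps :: "('a, 'b) mps \<Rightarrow> ('a, 'b) mps" where
  "inverse_mps f = (if f dvd 1 then THE g. f * g = 1 else 0)"

definition divide_mps :: "('a, 'b) mps \<Rightarrow> ('a, 'b) mps \<Rightarrow> ('a, 'b) mps" where
  "divide_mps f g = f * inverse g"

instance ..

end

lemma mps_inverse_unique: "f * g = 1 \<Longrightarrow> inverse f = (g :: ('v, 'a :: comm_ring_1) mps)"
  unfolding inverse_mps_def
  by (auto intro!: the_equality simp: dvd_def)
     (metis mult.commute mult.left_commute mult.right_neutral)

lemma mps_coeff_power_eq_0:
  fixes u :: "('v, 'a :: comm_ring_1) mps"
  assumes "mps_coeff u {#} = 0" and "size m < n"
  shows "mps_coeff (u ^ n) m = 0"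
  using assms(2)
proof (induction n arbitrary: m)
  case (Suc n)
  have "mps_coeff u a * mps_coeff (u ^ n) b = 0" if "a + b = m" for a b
  proof (cases "a = {#}")
    case False
    then have "size b < n"
      using that Suc.prems by (cases a) auto
    then show ?thesis using Suc.IH by simp
  qed (simp add: assms)
  then show ?case by (auto simp: times_mps.rep_eq intro!: sum.neutral)
qed simp

lemma mps_coeff_sum: "mps_coeff (\<Sum>i\<in>A. f i) m = (\<Sum>i\<in>A. mps_coeff (f i) m)"
  by (induction A rule: infinite_finite_induct) (auto simp: zero_mps.rep_eq plus_mps.rep_eq)

lemma mps_mult_inverse:
  fixes f :: "('v, 'a :: comm_ring_1) mps"
  assumes "mps_coeff f {#} = 1"
  shows "f * inverse f = 1"
proof -
  define u where "u = 1 - f"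
  have u0: "mps_coeff u {#} = 0"
    by (simp add: u_def minus_mps.rep_eq one_mps.rep_eq assms)
  define S where "S = (\<lambda>N. \<Sum>n<N. u ^ n)"
  define g where "g = Abs_mps (\<lambda>m. mps_coeff (S (Suc (size m))) m)"
  have S_stable: "mps_coeff (S N) m = mps_coeff g m" if "size m < N" for N m
  proof -
    have "mps_coeff (S N) m = mps_coeff (S (Suc (size m))) m"
      unfolding S_def mps_coeff_sum
      using that by (intro sum.mono_neutral_right) (auto simp: mps_coeff_power_eq_0 u0)
    then show ?thesis by (simp add: g_def Abs_mps_inverse)
  qed
  have fS: "f * S N = 1 - u ^ N" for N
    unfolding S_def by (subst one_diff_power_eq) (simp add: u_def)
  have "f * g = 1"
  proof (rule mps_eqI)
    fix m
    have "mps_coeff (f * g) m = mps_coeff (f * S (Suc (size m))) m"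
      unfolding times_mps.rep_eq
      by (rule sum.cong) (auto simp: S_stable)
    also have "\<dots> = mps_coeff 1 m"
      by (simp only: fS minus_mps.rep_eq) (simp add: mps_coeff_power_eq_0 u0 del: power_Suc)
    finally show "mps_coeff (f * g) m = mps_coeff 1 m" .
  qed
  then show ?thesis using mps_inverse_unique by metis
qed

section \<open>Labeled trees\<close>

text \<open>
  \<^typ>\<open>nat tree\<close> is the type of plane binary trees with labeled nodes: \<^const>\<open>Leaf\<close> is the absent
  child, and \<^const>\<open>size\<close> counts nodes.
\<close>

definition labeled_trees :: "nat \<Rightarrow> nat tree set" where
  "labeled_trees n = {T. size T = n \<and> (\<forall>a \<in> set_tree T. 1 \<le> a)}"

fun lasc :: "nat tree \<Rightarrow> nat" where
  "lasc Leaf = 0"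
| "lasc (Node l a r) =
     (case l of Leaf \<Rightarrow> 0 | Node _ b _ \<Rightarrow> if b \<le> a then 1 else 0) + lasc l + lasc r"

fun ldes :: "nat tree \<Rightarrow> nat" where
  "ldes Leaf = 0"
| "ldes (Node l a r) =
     (case l of Leaf \<Rightarrow> 0 | Node _ b _ \<Rightarrow> if b \<le> a then 0 else 1) + ldes l + ldes r"

fun rasc :: "nat tree \<Rightarrow> nat" where
  "rasc Leaf = 0"
| "rasc (Node l a r) =
     (case r of Leaf \<Rightarrow> 0 | Node _ b _ \<Rightarrow> if a \<le> b then 1 else 0) + rasc l + rasc r"

fun rdes :: "nat tree \<Rightarrow> nat" where
  "rdes Leaf = 0"
| "rdes (Node l a r) =
     (case r of Leaf \<Rightarrow> 0 | Node _ b _ \<Rightarrow> if a \<le> b then 0 else 1) + rdes l + rdes r"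

section \<open>The generating functions\<close>

datatype param = LamBar | Lam | RhoBar | Rho

text \<open>The coefficient ring, polynomials over the rationals in the four indeterminates.\<close>

type_synonym coeffs = "(param \<Rightarrow>\<^sub>0 nat) \<Rightarrow>\<^sub>0 rat"

text \<open>
  Indeterminates \<open>x\<^sub>i\<close> are indexed by all natural numbers, but only those with \<open>i \<ge> 1\<close> occur
  in the series below.
\<close>

type_synonym series = "(nat, coeffs) mps"

definition indet :: "param \<Rightarrow> series" where
  "indet p = mps_const (Poly_Mapping.single (Poly_Mapping.single p 1) 1)"

abbreviation lam_bar :: series where "lam_bar \<equiv> indet LamBar"
abbreviation lam :: series where "lam \<equiv> indet Lam"
abbreviation rho_bar :: series where "rho_bar \<equiv> indet RhoBar"
abbreviation rho :: series where "rho \<equiv> indet Rho"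

definition tree_weight :: "nat tree \<Rightarrow> series" where
  "tree_weight T = lam_bar ^ lasc T * lam ^ ldes T * rho_bar ^ rasc T * rho ^ rdes T *
     mps_monom (mset_tree T)"

definition tree_gf :: series where
  "tree_gf = formal_sum (\<Union>n\<in>{1..}. labeled_trees n) tree_weight"

text \<open>\<open>h\<^sub>n\<close> is the sum of all monomials of degree \<open>n\<close> in \<open>x\<^sub>1, x\<^sub>2, \<dots>\<close>.\<close>

definition complete_homogeneous :: "nat \<Rightarrow> series" where
  "complete_homogeneous n = Abs_mps (\<lambda>m. if size m = n \<and> (\<forall>i \<in># m. 1 \<le> i) then 1 else 0)"

definition complete_homogeneous_gf :: "series \<Rightarrow> series" where
  "complete_homogeneous_gf z = formal_sum UNIV (\<lambda>n. complete_homogeneous n * z ^ n)"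

lemma mps_const_mult: "mps_const c * mps_const d = mps_const (c * d :: 'a :: comm_ring_1)"
proof (rule mps_eqI)
  fix m :: "'v multiset"
  have "mps_coeff (mps_const c * mps_const d) m =
      (\<Sum>(a, b) \<in> {(a, b). a + b = m} \<inter> {({#}, {#})}.
        mps_coeff (mps_const c) a * mps_coeff (mps_const d) b)"
    unfolding times_mps.rep_eq
    by (rule sum.mono_neutral_right) (auto simp: mps_const.rep_eq split: if_splits)
  then show "mps_coeff (mps_const c * mps_const d) m = mps_coeff (mps_const (c * d)) m"
    by (auto simp: mps_const.rep_eq)
qed

lemma mps_const_power: "mps_const c ^ n = (mps_const (c ^ n) :: ('v, 'a :: comm_ring_1) mps)"
proof (induction n)
  case 0
  show ?case by (rule mps_eqI) (simp add: one_mps.rep_eq mps_const.rep_eq)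
qed (simp add: mps_const_mult)

lemma mps_coeff_const_mult:
  fixes f :: "('v, 'a :: comm_ring_1) mps"
  shows "mps_coeff (mps_const c * f) m = c * mps_coeff f m"
proof -
  have "mps_coeff (mps_const c * f) m =
      (\<Sum>(a, b) \<in> {({#} :: 'v multiset, m)}. mps_coeff (mps_const c) a * mps_coeff f b)"
    unfolding times_mps.rep_eq
    by (rule sum.mono_neutral_right) (auto simp: mps_const.rep_eq split: if_splits)
  then show ?thesis by (simp add: mps_const.rep_eq)
qed

lemma mps_coeff_tree_weight: "mps_coeff (tree_weight T) m \<noteq> 0 \<Longrightarrow> mset_tree T = m"
  unfolding tree_weight_def indet_def mps_const_power mps_const_mult mps_coeff_const_mult
  by (auto simp: mps_monom.rep_eq split: if_splits)

lemma finite_trees_bounded: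
  assumes "finite A"
  shows "finite {T. set_tree T \<subseteq> A \<and> size T \<le> n}"
proof (induction n)
  case 0
  have "{T. set_tree T \<subseteq> A \<and> size T \<le> 0} \<subseteq> {Leaf}" by auto
  then show ?case by (rule finite_subset) simp
next
  case (Suc n)
  let ?B = "{T. set_tree T \<subseteq> A \<and> size T \<le> n}"
  have "{T. set_tree T \<subseteq> A \<and> size T \<le> Suc n} \<subseteq>
          insert Leaf ((\<lambda>(l, a, r). Node l a r) ` (?B \<times> A \<times> ?B))"
  proof
    fix T assume "T \<in> {T. set_tree T \<subseteq> A \<and> size T \<le> Suc n}"
    then show "T \<in> insert Leaf ((\<lambda>(l, a, r). Node l a r) ` (?B \<times> A \<times> ?B))"
      by (cases T) (auto simp: image_iff)
  qed
  then show ?case by (rule finite_subset) (use Suc assms in auto)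
qed

lemma locally_finite_tree_gf: "locally_finite (\<Union>n\<in>{1..}. labeled_trees n) tree_weight"
  unfolding locally_finite_def
proof
  fix m
  have "{T \<in> \<Union>n\<in>{1..}. labeled_trees n. mps_coeff (tree_weight T) m \<noteq> 0} \<subseteq>
          {T. set_tree T \<subseteq> set_mset m \<and> size T \<le> size m}"
    using mps_coeff_tree_weight by (auto simp flip: size_mset_tree set_mset_tree)
  then show "finite {T \<in> \<Union>n\<in>{1..}. labeled_trees n. mps_coeff (tree_weight T) m \<noteq> 0}"
    by (rule finite_subset) (simp add: finite_trees_bounded)
qed

lemma locally_finite_complete_homogeneous_gf:
  "locally_finite UNIV (\<lambda>n. complete_homogeneous n * z ^ n)"
  unfolding locally_finite_def
proof
  fix m
  have "mps_coeff (complete_homogeneous n * z ^ n) m = 0" if "size m < n" for n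
    using that
    by (auto simp: times_mps.rep_eq complete_homogeneous_def Abs_mps_inverse intro!: sum.neutral)
  then have "{n \<in> UNIV. mps_coeff (complete_homogeneous n * z ^ n) m \<noteq> 0} \<subseteq> {..size m}"
    by (auto simp: not_less[symmetric])
  then show "finite {n \<in> UNIV. mps_coeff (complete_homogeneous n * z ^ n) m \<noteq> 0}"
    by (rule finite_subset) simp
qed

lemma mps_coeff_tree_gf_empty: "mps_coeff tree_gf {#} = 0"
proof -
  have empty: "{T \<in> \<Union>n\<in>{1..}. labeled_trees n. mps_coeff (tree_weight T) {#} \<noteq> 0} = {}"
    using mps_coeff_tree_weight by (fastforce simp: labeled_trees_def)
  then show ?thesis
    unfolding tree_gf_def formal_sum_def Abs_mps_inverse[OF UNIV_I] empty by simp
qed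

lemma denominator_inverse:
  "((1 + lam * tree_gf) * (1 + rho * tree_gf)) *
     inverse ((1 + lam * tree_gf) * (1 + rho * tree_gf)) = 1"
proof (rule mps_mult_inverse)
  have "{(a, b). a = {#} \<and> b = {#}} = {({#} :: nat multiset, {#} :: nat multiset)}" by auto
  then show "mps_coeff ((1 + lam * tree_gf) * (1 + rho * tree_gf)) {#} = 1"
    by (simp add: times_mps.rep_eq plus_mps.rep_eq one_mps.rep_eq mps_coeff_tree_gf_empty)
qed

end

theory Submission
  imports Defs
begin

text \<open>
  Let \<open>S\<^sub>k\<close> be the generating function of the trees whose root label is at most \<open>k\<close>. Removing the
  root gives
  \<open>S\<^sub>k - S\<^sub>k\<^sub>-\<^sub>1 = x\<^sub>k (1 + \<lambda>' S\<^sub>k + \<lambda> (G - S\<^sub>k)) (1 + \<rho>' (G - S\<^sub>k\<^sub>-\<^sub>1) + \<rho> S\<^sub>k\<^sub>-\<^sub>1)\<close>, where \<open>\<lambda>'\<close> and \<open>\<rho>'\<close>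
  stand for the barred parameters. For \<open>G\<close> fixed this is a Moebius recursion in \<open>S\<^sub>k\<close>, which
  the quotient of \<open>a\<^sub>k = 1 + \<lambda> G + (\<lambda>' - \<lambda>) S\<^sub>k\<close> and \<open>c\<^sub>k = 1 + \<rho>' G - (\<rho>' - \<rho>) S\<^sub>k\<close> linearises:
  \<open>(\<rho>' - \<rho>) a\<^sub>k + (\<lambda>' - \<lambda>) c\<^sub>k\<close> is the argument \<open>z\<close> of \<open>H\<close>, independently of \<open>k\<close>, and hence
  \<open>a\<^sub>k c\<^sub>k\<^sub>-\<^sub>1 (1 - x\<^sub>k z) = a\<^sub>k\<^sub>-\<^sub>1 c\<^sub>k\<close>. Telescoping and letting \<open>k\<close> tend to infinity gives the theorem,
  as \<open>a\<^sub>k\<close> runs from \<open>1 + \<lambda> G\<close> to \<open>1 + \<lambda>' G\<close> and \<open>c\<^sub>k\<close> from \<open>1 + \<rho>' G\<close> to \<open>1 + \<rho> G\<close>.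
\<close>

section \<open>Power series modulo the monomials that do not divide a given one\<close>

text \<open>All divisors of \<open>m\<close> are compared, not \<open>m\<close> alone, so that the
  relation is compatible with products. Congruence modulo every \<open>m\<close> is equality, and
  this replaces limits of series.\<close>

definition mps_cong :: "'v multiset \<Rightarrow> ('v, 'a) mps \<Rightarrow> ('v, 'a) mps \<Rightarrow> bool" where
  "mps_cong m f g \<longleftrightarrow> (\<forall>b. b \<subseteq># m \<longrightarrow> mps_coeff f b = mps_coeff g b)"

lemma mps_cong_refl [simp]: "mps_cong m f f"
  by (simp add: mps_cong_def)

lemma mps_cong_sym: "mps_cong m f g \<Longrightarrow> mps_cong m g f"
  by (simp add: mps_cong_def)

lemma mps_cong_trans [trans]: "mps_cong m f g \<Longrightarrow> mps_cong m g h \<Longrightarrow> mps_cong m f h"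
  by (simp add: mps_cong_def)

lemma mps_cong_coeff: "mps_cong m f g \<Longrightarrow> mps_coeff f m = mps_coeff g m"
  by (simp add: mps_cong_def)

lemma mps_eq_if_cong: "(\<And>m. mps_cong m f g) \<Longrightarrow> f = g"
  by (blast intro: mps_eqI mps_cong_coeff)

lemma mps_cong_add:
  fixes f g f' g' :: "('v, 'a :: comm_ring_1) mps"
  shows "mps_cong m f f' \<Longrightarrow> mps_cong m g g' \<Longrightarrow> mps_cong m (f + g) (f' + g')"
  by (simp add: mps_cong_def plus_mps.rep_eq)

lemma mps_cong_diff:
  fixes f g f' g' :: "('v, 'a :: comm_ring_1) mps"
  shows "mps_cong m f f' \<Longrightarrow> mps_cong m g g' \<Longrightarrow> mps_cong m (f - g) (f' - g')"
  by (simp add: mps_cong_def minus_mps.rep_eq)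

lemma mps_cong_mult:
  fixes f g f' g' :: "('v, 'a :: comm_ring_1) mps"
  assumes "mps_cong m f f'" and "mps_cong m g g'"
  shows "mps_cong m (f * g) (f' * g')"
  unfolding mps_cong_def
proof (intro allI impI)
  fix b assume b: "b \<subseteq># m"
  have "mps_coeff f c * mps_coeff g d = mps_coeff f' c * mps_coeff g' d" if "c + d = b" for c d
  proof -
    have "c \<subseteq># b" "d \<subseteq># b"
      using that by auto
    then have "c \<subseteq># m" "d \<subseteq># m"
      using b by (auto intro: subset_mset.order_trans)
    then show ?thesis
      using assms by (simp add: mps_cong_def)
  qed
  then show "mps_coeff (f * g) b = mps_coeff (f' * g') b"
    unfolding times_mps.rep_eq by (intro sum.cong) auto
qed

section \<open>Formal sums\<close>

lemma formal_sum_coeff: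
  assumes "finite I'" and "I' \<subseteq> I" and "\<And>i. i \<in> I - I' \<Longrightarrow> mps_coeff (f i) m = 0"
  shows "mps_coeff (formal_sum I f) m = (\<Sum>i\<in>I'. mps_coeff (f i) m)"
  unfolding formal_sum_def Abs_mps_inverse[OF UNIV_I]
  by (rule sum.mono_neutral_left) (use assms in auto)

lemma formal_sum_cong_finite:
  fixes f :: "'i \<Rightarrow> ('v, 'a :: comm_ring_1) mps"
  assumes "finite I'" and "I' \<subseteq> I"
    and "\<And>i b. i \<in> I - I' \<Longrightarrow> b \<subseteq># m \<Longrightarrow> mps_coeff (f i) b = 0"
  shows "mps_cong m (formal_sum I f) (\<Sum>i\<in>I'. f i)"
  unfolding mps_cong_def mps_coeff_sum using assms by (auto intro!: formal_sum_coeff)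

lemma finite_submultisets: "finite {b. b \<subseteq># (m :: 'v multiset)}"
proof (rule finite_subset)
  show "{b. b \<subseteq># m} \<subseteq> fst ` {(a, b). a + b = m}"
  proof
    fix b assume "b \<in> {b. b \<subseteq># m}"
    then show "b \<in> fst ` {(a, b). a + b = m}"
      by (intro image_eqI[where x = "(b, m - b)"]) auto
  qed
qed auto

text \<open>Local finiteness treats one monomial at a time; as \<open>m\<close> has only finitely
  many divisors, the union of their index sets serves all of them at once.\<close>

lemma locally_finite_support:
  assumes "locally_finite I f"
  obtains I' where "finite I'" and "I' \<subseteq> I"
    and "\<And>i b. i \<in> I - I' \<Longrightarrow> b \<subseteq># m \<Longrightarrow> mps_coeff (f i) b = 0"
proof
  let ?I = "\<Union>b\<in>{b. b \<subseteq># m}. {i \<in> I. mps_coeff (f i) b \<noteq> 0}"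
  show "finite ?I"
    using assms finite_submultisets by (auto simp: locally_finite_def)
  show "?I \<subseteq> I" by auto
  show "mps_coeff (f i) b = 0" if "i \<in> I - ?I" "b \<subseteq># m" for i b
    using that by auto
qed

lemma locally_finite_subset: "locally_finite I f \<Longrightarrow> J \<subseteq> I \<Longrightarrow> locally_finite J f"
  unfolding locally_finite_def by (blast intro: rev_finite_subset)

lemma locally_finite_Un: "locally_finite (I \<union> J) f \<longleftrightarrow> locally_finite I f \<and> locally_finite J f"
proof -
  have "{i \<in> I \<union> J. mps_coeff (f i) m \<noteq> 0} =
      {i \<in> I. mps_coeff (f i) m \<noteq> 0} \<union> {i \<in> J. mps_coeff (f i) m \<noteq> 0}" for m
    by auto
  then show ?thesis by (auto simp: locally_finite_def)
qed

lemma locally_finite_finite: "finite I \<Longrightarrow> locally_finite I f"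
  by (simp add: locally_finite_def)

lemma formal_sum_finite:
  fixes f :: "'i \<Rightarrow> ('v, 'a :: comm_ring_1) mps"
  shows "finite I \<Longrightarrow> formal_sum I f = (\<Sum>i\<in>I. f i)"
  by (rule mps_eq_if_cong, rule formal_sum_cong_finite) auto

lemma formal_sum_reindex:
  assumes "inj_on h I"
  shows "formal_sum (h ` I) f = formal_sum I (\<lambda>i. f (h i))"
proof -
  have "{j \<in> h ` I. mps_coeff (f j) m \<noteq> 0} = h ` {i \<in> I. mps_coeff (f (h i)) m \<noteq> 0}" for m
    by auto
  moreover have "inj_on h {i \<in> I. mps_coeff (f (h i)) m \<noteq> 0}" for m
    using assms by (rule inj_on_subset) auto
  ultimately show ?thesis
    unfolding formal_sum_def by (simp add: sum.reindex)
qed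

lemma formal_sum_cong:
  "(\<And>i. i \<in> I \<Longrightarrow> f i = g i) \<Longrightarrow> formal_sum I f = formal_sum I g"
  unfolding formal_sum_def by (simp cong: conj_cong)

lemma formal_sum_Un:
  fixes f :: "'i \<Rightarrow> ('v, 'a :: comm_ring_1) mps"
  assumes "locally_finite I f" and "locally_finite J f" and "I \<inter> J = {}"
  shows "formal_sum (I \<union> J) f = formal_sum I f + formal_sum J f"
proof (rule mps_eqI)
  fix m
  let ?S = "\<lambda>I. {i \<in> I. mps_coeff (f i) m \<noteq> 0}"
  have "?S (I \<union> J) = ?S I \<union> ?S J" by auto
  then show "mps_coeff (formal_sum (I \<union> J) f) m = mps_coeff (formal_sum I f + formal_sum J f) m"
    using assms unfolding formal_sum_def locally_finite_def
    by (auto simp: plus_mps.rep_eq Abs_mps_inverse intro!: sum.union_disjoint)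
qed

lemma mps_coeff_mult_eq_0:
  fixes f g :: "('v, 'a :: comm_ring_1) mps"
  assumes "\<And>b. b \<subseteq># m \<Longrightarrow> mps_coeff f b = 0"
  shows "mps_coeff (f * g) m = 0"
  using assms by (auto simp: times_mps.rep_eq intro!: sum.neutral)

text \<open>Modulo \<open>m\<close> both sums become finite and distributivity applies; a product
  indexed outside \<open>I' \<times> J'\<close> has a factor that vanishes on all divisors of
  \<open>m\<close>.\<close>

lemma
  fixes f :: "'i \<Rightarrow> ('v, 'a :: comm_ring_1) mps"
  assumes f: "locally_finite I f" and g: "locally_finite J g"
  shows formal_sum_mult:
      "formal_sum I f * formal_sum J g = formal_sum (I \<times> J) (\<lambda>(i, j). f i * g j)"
    and locally_finite_mult: "locally_finite (I \<times> J) (\<lambda>(i, j). f i * g j)"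
proof -
  have support: "\<exists>I' J'. finite I' \<and> finite J' \<and> I' \<subseteq> I \<and> J' \<subseteq> J \<and>
      mps_cong m (formal_sum I f) (sum f I') \<and> mps_cong m (formal_sum J g) (sum g J') \<and>
      (\<forall>p\<in>I \<times> J - I' \<times> J'. \<forall>b. b \<subseteq># m \<longrightarrow> mps_coeff (f (fst p) * g (snd p)) b = 0)" for m
  proof -
    obtain I' where I': "finite I'" "I' \<subseteq> I"
      "\<And>i b. i \<in> I - I' \<Longrightarrow> b \<subseteq># m \<Longrightarrow> mps_coeff (f i) b = 0"
      using locally_finite_support[OF f] by metis
    obtain J' where J': "finite J'" "J' \<subseteq> J"
      "\<And>j b. j \<in> J - J' \<Longrightarrow> b \<subseteq># m \<Longrightarrow> mps_coeff (g j) b = 0"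
      using locally_finite_support[OF g] by metis
    have "mps_coeff (f (fst p) * g (snd p)) b = 0"
      if "p \<in> I \<times> J - I' \<times> J'" "b \<subseteq># m" for p b
    proof (cases "fst p \<in> I'")
      case True
      have "mps_coeff (g (snd p) * f (fst p)) b = 0"
        by (rule mps_coeff_mult_eq_0, rule J'(3))
           (use that True in \<open>auto intro: subset_mset.order_trans\<close>)
      then show ?thesis by (simp add: mult.commute)
    next
      case False
      show ?thesis
        by (rule mps_coeff_mult_eq_0, rule I'(3))
           (use that False in \<open>auto intro: subset_mset.order_trans\<close>)
    qed
    moreover have "mps_cong m (formal_sum I f) (sum f I')" "mps_cong m (formal_sum J g) (sum g J')"
      using I' J' by (auto intro!: formal_sum_cong_finite)
    ultimately show ?thesis
      using I'(1,2) J'(1,2) by (intro exI[of _ I'] exI[of _ J'] conjI ballI allI impI) assumption+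
  qed
  show "formal_sum I f * formal_sum J g = formal_sum (I \<times> J) (\<lambda>(i, j). f i * g j)"
  proof (rule mps_eq_if_cong)
    fix m
    obtain I' J' where *: "finite I'" "finite J'" "I' \<subseteq> I" "J' \<subseteq> J"
      "mps_cong m (formal_sum I f) (sum f I')" "mps_cong m (formal_sum J g) (sum g J')"
      "\<And>p b. p \<in> I \<times> J - I' \<times> J' \<Longrightarrow> b \<subseteq># m \<Longrightarrow> mps_coeff (f (fst p) * g (snd p)) b = 0"
      using support by metis
    have "mps_cong m (formal_sum I f * formal_sum J g) (sum f I' * sum g J')"
      by (intro mps_cong_mult *)
    also have "sum f I' * sum g J' = (\<Sum>p\<in>I' \<times> J'. case p of (i, j) \<Rightarrow> f i * g j)"
      by (simp add: sum_product sum.cartesian_product)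
    also have "mps_cong m \<dots> (formal_sum (I \<times> J) (\<lambda>(i, j). f i * g j))"
      by (rule mps_cong_sym, rule formal_sum_cong_finite)
         (use * in \<open>auto simp: case_prod_unfold\<close>)
    finally show "mps_cong m (formal_sum I f * formal_sum J g)
        (formal_sum (I \<times> J) (\<lambda>(i, j). f i * g j))" .
  qed
  show "locally_finite (I \<times> J) (\<lambda>(i, j). f i * g j)"
    unfolding locally_finite_def
  proof
    fix m
    obtain I' J' where *: "finite I'" "finite J'"
      "\<And>p b. p \<in> I \<times> J - I' \<times> J' \<Longrightarrow> b \<subseteq># m \<Longrightarrow> mps_coeff (f (fst p) * g (snd p)) b = 0"
      using support by metis
    have "{p \<in> I \<times> J. mps_coeff (case p of (i, j) \<Rightarrow> f i * g j) m \<noteq> 0} \<subseteq> I' \<times> J'"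
      using *(3)[OF _ subset_mset.order_refl] by fastforce
    then show "finite {p \<in> I \<times> J. mps_coeff (case p of (i, j) \<Rightarrow> f i * g j) m \<noteq> 0}"
      by (rule finite_subset) (use * in auto)
  qed
qed

lemma
  fixes f :: "'i \<Rightarrow> ('v, 'a :: comm_ring_1) mps"
  assumes "locally_finite I f"
  shows formal_sum_const_mult: "formal_sum I (\<lambda>i. c * f i) = c * formal_sum I f"
    and locally_finite_const_mult: "locally_finite I (\<lambda>i. c * f i)"
proof -
  \<comment> \<open>The constant is a sum over a single index, so both claims become cases of the
    product rule.\<close>
  have c: "locally_finite {()} (\<lambda>_. c)"
    by (rule locally_finite_finite) simp
  have I: "{()} \<times> I = Pair () ` I" "inj_on (Pair ()) I"
    by (auto simp: inj_on_def)
  have "c * formal_sum I f = formal_sum ({()} \<times> I) (\<lambda>(_, i). c * f i)"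
    using formal_sum_mult[OF c assms] by (simp add: formal_sum_finite)
  also have "\<dots> = formal_sum I (\<lambda>i. c * f i)"
    unfolding I(1) by (simp add: formal_sum_reindex[OF I(2)])
  finally show "formal_sum I (\<lambda>i. c * f i) = c * formal_sum I f" ..
  show "locally_finite I (\<lambda>i. c * f i)"
    unfolding locally_finite_def
  proof
    fix m
    have "{i \<in> I. mps_coeff (c * f i) m \<noteq> 0} =
        snd ` {p \<in> {()} \<times> I. mps_coeff (case p of (_, i) \<Rightarrow> c * f i) m \<noteq> 0}"
      by (auto simp: image_iff)
    then show "finite {i \<in> I. mps_coeff (c * f i) m \<noteq> 0}"
      using locally_finite_mult[OF c assms] by (simp add: locally_finite_def)
  qed
qed

section \<open>Decomposition of trees at the root\<close>

lemma mps_coeff_monom_mult: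
  fixes f :: "('v, 'a :: comm_ring_1) mps"
  shows "mps_coeff (mps_monom A * f) m = (if A \<subseteq># m then mps_coeff f (m - A) else 0)"
proof -
  have "mps_coeff (mps_monom A * f) m =
      (\<Sum>(a, b) \<in> (if A \<subseteq># m then {(A, m - A)} else {}). mps_coeff (mps_monom A) a * mps_coeff f b)"
    unfolding times_mps.rep_eq
    by (rule sum.mono_neutral_right) (auto simp: mps_monom.rep_eq split: if_splits)
  then show ?thesis by (simp add: mps_monom.rep_eq)
qed

lemma mps_monom_mult: "mps_monom A * mps_monom B = (mps_monom (A + B) :: ('v, 'a :: comm_ring_1) mps)"
  by (rule mps_eqI) (auto simp: mps_coeff_monom_mult mps_monom.rep_eq subset_mset.le_iff_add)

lemma mps_monom_empty: "mps_monom {#} = (1 :: ('v, 'a :: comm_ring_1) mps)"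
  by (rule mps_eqI) (simp add: mps_monom.rep_eq one_mps.rep_eq)

abbreviation mps_var :: "nat \<Rightarrow> series" where
  "mps_var k \<equiv> mps_monom {#k#}"

text \<open>\<open>Leaf\<close> is included: these are the possible subtrees of a node, absent
  children among them.\<close>

definition positive_trees :: "nat tree set" where
  "positive_trees = {T. \<forall>a \<in> set_tree T. 1 \<le> a}"

definition trees_root :: "nat set \<Rightarrow> nat tree set" where
  "trees_root A = {T \<in> positive_trees. T \<noteq> Leaf \<and> value T \<in> A}"

text \<open>\<open>root_gf {..k}\<close> is the \<open>S\<^sub>k\<close> of the overview. Arbitrary
  label sets also cover \<open>G - S\<^sub>k\<close> and the trees with root label exactly
  \<open>k\<close>.\<close>

definition root_gf :: "nat set \<Rightarrow> series" where
  "root_gf A = formal_sum (trees_root A) tree_weight"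

lemma trees_root_UNIV: "trees_root UNIV = (\<Union>n\<in>{1..}. labeled_trees n)"
  by (auto simp: trees_root_def positive_trees_def labeled_trees_def Suc_le_eq
      simp flip: eq_size_0)

lemma locally_finite_trees_root: "locally_finite (trees_root A) tree_weight"
  using locally_finite_tree_gf unfolding trees_root_UNIV[symmetric]
  by (rule locally_finite_subset) (auto simp: trees_root_def)

lemma tree_gf_eq_root_gf: "tree_gf = root_gf UNIV"
  by (simp add: tree_gf_def root_gf_def trees_root_UNIV)

lemma root_gf_Un:
  assumes "A \<inter> B = {}"
  shows "root_gf (A \<union> B) = root_gf A + root_gf B"
proof -
  have "trees_root (A \<union> B) = trees_root A \<union> trees_root B" "trees_root A \<inter> trees_root B = {}"
    using assms by (auto simp: trees_root_def)
  then show ?thesis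
    unfolding root_gf_def by (simp add: formal_sum_Un locally_finite_trees_root)
qed

lemma root_gf_Compl: "root_gf (- A) = tree_gf - root_gf A"
  using root_gf_Un[of A "- A"] by (simp add: tree_gf_eq_root_gf Compl_partition)

text \<open>The root label of a tree is positive and occurs in its monomial. This yields
  \<open>S\<^sub>0 = 0\<close>, the vanishing of constant terms, and the convergence of
  \<open>S\<^sub>k\<close> to \<open>G\<close>.\<close>

lemma root_gf_cong_0:
  assumes "A \<inter> set_mset m \<inter> {1..} = {}"
  shows "mps_cong m (root_gf A) 0"
proof -
  have "mps_coeff (tree_weight T) b = 0" if "T \<in> trees_root A" "b \<subseteq># m" for T b
  proof (rule ccontr)
    assume "mps_coeff (tree_weight T) b \<noteq> 0"
    then have "mset_tree T = b" by (rule mps_coeff_tree_weight)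
    moreover have "value T \<in> set_tree T" "value T \<in> A" "1 \<le> value T"
      using that(1) by (cases T; simp add: trees_root_def positive_trees_def)+
    ultimately show False
      using assms that(2) by (fastforce simp flip: set_mset_tree dest: mset_subset_eqD)
  qed
  then have "mps_cong m (formal_sum (trees_root A) tree_weight) (sum tree_weight {})"
    by (intro formal_sum_cong_finite) auto
  then show ?thesis by (simp add: root_gf_def)
qed

text \<open>The case distinction is the weight of the edge joining the subtree to its parent:
  \<open>A\<close> holds the child labels that make this edge an ascent, and an absent child has no
  edge.\<close>

definition child_factor :: "nat set \<Rightarrow> series \<Rightarrow> series \<Rightarrow> nat tree \<Rightarrow> series" where
  "child_factor A c d T =
     (case T of Leaf \<Rightarrow> 1 | Node _ b _ \<Rightarrow> if b \<in> A then c else d) * tree_weight T"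

lemma tree_weight_Leaf: "tree_weight Leaf = 1"
  by (simp add: tree_weight_def mps_monom_empty)

text \<open>Equal labels give an ascent on either side, so \<open>a\<close> belongs to both label
  sets.\<close>

lemma tree_weight_Node:
  "tree_weight (Node l a r) =
     mps_var a * (child_factor {..a} lam_bar lam l * child_factor {a..} rho_bar rho r)"
proof -
  have "mps_monom (mset_tree (Node l a r)) =
      mps_var a * (mps_monom (mset_tree l) * mps_monom (mset_tree r) :: series)"
    by (simp add: mps_monom_mult)
  then show ?thesis
    unfolding tree_weight_def child_factor_def
    by (cases l; cases r) (simp_all add: power_add ac_simps)
qed

lemma
  shows formal_sum_child_factor:
      "formal_sum positive_trees (child_factor A c d) = 1 + c * root_gf A + d * root_gf (- A)"
    and locally_finite_child_factor: "locally_finite positive_trees (child_factor A c d)"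
proof -
  let ?f = "child_factor A c d"
  have eq: "?f T = c * tree_weight T" if "T \<in> trees_root A" for T
    using that by (cases T) (auto simp: trees_root_def child_factor_def)
  have eq': "?f T = d * tree_weight T" if "T \<in> trees_root (- A)" for T
    using that by (cases T) (auto simp: trees_root_def child_factor_def)
  have lf: "locally_finite {Leaf} ?f"
    by (rule locally_finite_finite) simp
  have lfA: "locally_finite (trees_root A) ?f"
    using locally_finite_const_mult[OF locally_finite_trees_root[of A], of c] eq
    by (simp add: locally_finite_def cong: conj_cong)
  have lfA': "locally_finite (trees_root (- A)) ?f"
    using locally_finite_const_mult[OF locally_finite_trees_root[of "- A"], of d] eq'
    by (simp add: locally_finite_def cong: conj_cong)
  have lfU: "locally_finite (trees_root A \<union> trees_root (- A)) ?f"
    using lfA lfA' by (simp add: locally_finite_Un)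
  have pos: "positive_trees = {Leaf} \<union> (trees_root A \<union> trees_root (- A))"
    by (auto simp: trees_root_def positive_trees_def)
  show "locally_finite positive_trees ?f"
    unfolding pos using lf lfU by (simp only: locally_finite_Un)
  have "formal_sum positive_trees ?f =
      formal_sum {Leaf} ?f + formal_sum (trees_root A \<union> trees_root (- A)) ?f"
    unfolding pos by (rule formal_sum_Un[OF lf lfU]) (auto simp: trees_root_def)
  also have "formal_sum (trees_root A \<union> trees_root (- A)) ?f =
      formal_sum (trees_root A) ?f + formal_sum (trees_root (- A)) ?f"
    by (rule formal_sum_Un[OF lfA lfA']) (auto simp: trees_root_def)
  also have "formal_sum {Leaf} ?f = 1"
    by (simp add: formal_sum_finite child_factor_def tree_weight_Leaf)
  also have "formal_sum (trees_root A) ?f = c * root_gf A"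
    unfolding root_gf_def formal_sum_const_mult[OF locally_finite_trees_root, symmetric]
    by (rule formal_sum_cong) (rule eq)
  also have "formal_sum (trees_root (- A)) ?f = d * root_gf (- A)"
    unfolding root_gf_def formal_sum_const_mult[OF locally_finite_trees_root, symmetric]
    by (rule formal_sum_cong) (rule eq')
  finally show "formal_sum positive_trees ?f = 1 + c * root_gf A + d * root_gf (- A)"
    by (simp add: add.assoc)
qed

text \<open>Such a tree is a free choice of two possibly absent subtrees, and its weight factors
  accordingly, so the sum over pairs is a product of two sums.\<close>

lemma root_gf_singleton:
  assumes "1 \<le> k"
  shows "root_gf {k} = mps_var k *
    ((1 + lam_bar * root_gf {..k} + lam * root_gf (- {..k})) *
     (1 + rho_bar * root_gf {k..} + rho * root_gf (- {k..})))"
proof -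
  let ?node = "\<lambda>(l, r). Node l k r"
  let ?f = "\<lambda>(l, r). child_factor {..k} lam_bar lam l * child_factor {k..} rho_bar rho r"
  have inj: "inj_on ?node (positive_trees \<times> positive_trees)"
    by (auto simp: inj_on_def)
  have image: "trees_root {k} = ?node ` (positive_trees \<times> positive_trees)"
  proof (intro equalityI subsetI)
    fix T assume "T \<in> trees_root {k}"
    then show "T \<in> ?node ` (positive_trees \<times> positive_trees)"
      by (cases T) (auto simp: trees_root_def positive_trees_def image_iff)
  qed (use assms in \<open>auto simp: trees_root_def positive_trees_def\<close>)
  have "root_gf {k} = formal_sum (positive_trees \<times> positive_trees) (\<lambda>p. mps_var k * ?f p)"
    unfolding root_gf_def image formal_sum_reindex[OF inj]
    by (rule formal_sum_cong) (auto simp: tree_weight_Node)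
  also have "\<dots> = mps_var k * formal_sum (positive_trees \<times> positive_trees) ?f"
    by (intro formal_sum_const_mult locally_finite_mult locally_finite_child_factor)
  finally show ?thesis
    by (simp add: formal_sum_child_factor locally_finite_child_factor flip: formal_sum_mult)
qed

section \<open>Complete homogeneous symmetric functions in finitely many variables\<close>

text \<open>The complete homogeneous symmetric polynomial of degree \<open>n\<close> in the first
  \<open>k\<close> variables.\<close>

definition homogeneous_upto :: "nat \<Rightarrow> nat \<Rightarrow> series" where
  "homogeneous_upto k n = Abs_mps (\<lambda>m. if size m = n \<and> set_mset m \<subseteq> {1..k} then 1 else 0)"

lemma mps_coeff_homogeneous_upto:
  "mps_coeff (homogeneous_upto k n) m = (if size m = n \<and> set_mset m \<subseteq> {1..k} then 1 else 0)"
  by (simp add: homogeneous_upto_def Abs_mps_inverse)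

lemma homogeneous_upto_0_right: "homogeneous_upto k 0 = 1"
  by (rule mps_eqI) (auto simp: mps_coeff_homogeneous_upto one_mps.rep_eq)

lemma homogeneous_upto_0_left: "homogeneous_upto 0 (Suc n) = 0"
  by (rule mps_eqI) (auto simp: mps_coeff_homogeneous_upto zero_mps.rep_eq)

text \<open>A monomial either avoids the last variable or is divisible by it.\<close>

lemma homogeneous_upto_Suc:
  "homogeneous_upto (Suc k) (Suc n) =
     homogeneous_upto k (Suc n) + mps_var (Suc k) * homogeneous_upto (Suc k) n"
proof (rule mps_eqI)
  fix m
  show "mps_coeff (homogeneous_upto (Suc k) (Suc n)) m =
    mps_coeff (homogeneous_upto k (Suc n) + mps_var (Suc k) * homogeneous_upto (Suc k) n) m"
  proof (cases "Suc k \<in># m")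
    case True
    then obtain m' where "m = add_mset (Suc k) m'"
      by (auto dest: multi_member_split)
    then show ?thesis
      by (auto simp: plus_mps.rep_eq mps_coeff_monom_mult mps_coeff_homogeneous_upto)
  next
    case False
    then have "set_mset m \<subseteq> {1..Suc k} \<longleftrightarrow> set_mset m \<subseteq> {1..k}"
      by (auto simp: subset_iff le_Suc_eq)
    with False show ?thesis
      by (simp add: plus_mps.rep_eq mps_coeff_monom_mult mps_coeff_homogeneous_upto)
  qed
qed

text \<open>The last variable contributes a geometric series to the generating function; the
  subtracted term is the error of cutting off at \<open>N\<close>.\<close>

lemma homogeneous_upto_gf_Suc:
  "(\<Sum>n\<le>N. homogeneous_upto (Suc k) n * z ^ n) * (1 - mps_var (Suc k) * z) =
     (\<Sum>n\<le>N. homogeneous_upto k n * z ^ n) -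
     mps_var (Suc k) * homogeneous_upto (Suc k) N * z ^ Suc N"
proof (induction N)
  case 0
  show ?case by (simp add: homogeneous_upto_0_right)
next
  case (Suc N)
  then show ?case
    by (simp add: distrib_right homogeneous_upto_Suc) (simp add: algebra_simps)
qed

lemma homogeneous_upto_gf_cong:
  assumes "size m \<le> N"
  shows "mps_cong m
    ((\<Sum>n\<le>N. homogeneous_upto k n * z ^ n) * (\<Prod>i<k. 1 - mps_var (Suc i) * z)) 1"
proof (induction k)
  case 0
  have "(\<Sum>n\<le>N. homogeneous_upto 0 n * z ^ n) = 1"
    by (subst sum.atMost_shift) (simp add: homogeneous_upto_0_left homogeneous_upto_0_right)
  then show ?case by simp
next
  case (Suc k)
  let ?P = "\<lambda>k. \<Sum>n\<le>N. homogeneous_upto k n * z ^ n"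
  let ?Q = "\<lambda>k. \<Prod>i<k. 1 - mps_var (Suc i) * z"
  let ?e = "mps_var (Suc k) * homogeneous_upto (Suc k) N * z ^ Suc N"
  have "mps_cong m ?e 0"
    unfolding mps_cong_def
  proof (intro allI impI)
    fix b assume "b \<subseteq># m"
    then have "size b \<le> N"
      using assms size_mset_mono by fastforce
    \<comment> \<open>The error is negligible because this factor is homogeneous of degree
      \<open>N + 1\<close>. The power of \<open>z\<close> does not help, since \<open>z\<close> may
      have a nonzero constant term.\<close>
    have "mps_coeff (mps_var (Suc k) * homogeneous_upto (Suc k) N) c = 0" if "c \<subseteq># b" for c
    proof -
      have "size (c - {#Suc k#}) < N" if "Suc k \<in># c"
        using that \<open>c \<subseteq># b\<close> \<open>size b \<le> N\<close> size_mset_mono[of c b] size_Diff1_less[of "Suc k" c]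
        by linarith
      then show ?thesis
        by (auto simp: mps_coeff_monom_mult mps_coeff_homogeneous_upto)
    qed
    then show "mps_coeff ?e b = mps_coeff 0 b"
      by (simp add: mps_coeff_mult_eq_0 zero_mps.rep_eq del: power_Suc)
  qed
  then have "mps_cong m ((?P k - ?e) * ?Q k) ((?P k - 0) * ?Q k)"
    by (intro mps_cong_mult mps_cong_diff mps_cong_refl)
  also have "mps_cong m \<dots> 1"
    using Suc.IH by simp
  also have "(?P k - ?e) * ?Q k = ?P (Suc k) * ?Q (Suc k)"
    unfolding homogeneous_upto_gf_Suc[symmetric] by (simp add: ac_simps)
  finally show ?case .
qed

text \<open>Divisors of \<open>m\<close> involve only labels up to \<open>k\<close> and have degree
  at most \<open>size m\<close>, so both the variables and the sum may be truncated.\<close>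

lemma complete_homogeneous_gf_cong:
  assumes "set_mset m \<subseteq> {..k}"
  shows "mps_cong m (complete_homogeneous_gf z * (\<Prod>i<k. 1 - mps_var (Suc i) * z)) 1"
proof -
  have "mps_cong m (complete_homogeneous_gf z) (\<Sum>n\<le>size m. complete_homogeneous n * z ^ n)"
    unfolding complete_homogeneous_gf_def
  proof (rule formal_sum_cong_finite)
    fix n b assume n: "n \<in> UNIV - {..size m}" and "b \<subseteq># m"
    then have "size b < n"
      using size_mset_mono[of b m] by simp
    show "mps_coeff (complete_homogeneous n * z ^ n) b = 0"
    proof (rule mps_coeff_mult_eq_0)
      fix c assume "c \<subseteq># b"
      then show "mps_coeff (complete_homogeneous n) c = 0"
        using size_mset_mono[of c b] \<open>size b < n\<close>
        by (auto simp: complete_homogeneous_def Abs_mps_inverse)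
    qed
  qed auto
  also have "mps_cong m \<dots> (\<Sum>n\<le>size m. homogeneous_upto k n * z ^ n)"
  proof -
    have "mps_cong m (complete_homogeneous n) (homogeneous_upto k n)" for n
      using assms unfolding mps_cong_def
      by (auto simp: complete_homogeneous_def Abs_mps_inverse mps_coeff_homogeneous_upto
            subset_iff dest: mset_subset_eqD)
    then have "mps_cong m (complete_homogeneous n * z ^ n) (homogeneous_upto k n * z ^ n)" for n
      by (intro mps_cong_mult mps_cong_refl)
    then show ?thesis by (simp add: mps_cong_def mps_coeff_sum)
  qed
  finally have "mps_cong m (complete_homogeneous_gf z * (\<Prod>i<k. 1 - mps_var (Suc i) * z))
      ((\<Sum>n\<le>size m. homogeneous_upto k n * z ^ n) * (\<Prod>i<k. 1 - mps_var (Suc i) * z))"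
    by (intro mps_cong_mult mps_cong_refl)
  also have "mps_cong m \<dots> 1"
    by (rule homogeneous_upto_gf_cong) simp
  finally show ?thesis .
qed

section \<open>The Moebius recursion\<close>

lemma moebius_step:
  fixes \<alpha> \<beta> \<gamma> \<delta> s t x :: "'a :: comm_ring_1"
  assumes "t - s = x * ((\<alpha> + \<beta> * t) * (\<gamma> - \<delta> * s))"
  shows "(\<alpha> + \<beta> * t) * (1 - x * (\<alpha> * \<delta> + \<beta> * \<gamma>)) * (\<gamma> - \<delta> * s) =
    (\<alpha> + \<beta> * s) * (\<gamma> - \<delta> * t)"
proof -
  \<comment> \<open>Taking \<open>a\<close> at \<open>t\<close> but \<open>c\<close> at
    \<open>s\<close> makes the increment the monomial \<open>x * (a * c)\<close>; then all other
    quantities are polynomials in \<open>a\<close>, \<open>c\<close>, \<open>x\<close>,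
    \<open>\<beta>\<close> and \<open>\<delta>\<close>.\<close>
  define a c where "a = \<alpha> + \<beta> * t" and "c = \<gamma> - \<delta> * s"
  have ts: "t - s = x * (a * c)"
    using assms by (simp only: a_def c_def)
  have "\<alpha> + \<beta> * s = a - \<beta> * (t - s)" "\<gamma> - \<delta> * t = c - \<delta> * (t - s)"
    by (simp_all add: a_def c_def algebra_simps)
  then have s: "\<alpha> + \<beta> * s = a - \<beta> * (x * (a * c))" and t: "\<gamma> - \<delta> * t = c - \<delta> * (x * (a * c))"
    by (simp_all only: ts)
  have "\<alpha> * \<delta> + \<beta> * \<gamma> = \<delta> * (\<alpha> + \<beta> * s) + \<beta> * c"
    by (simp add: c_def algebra_simps)
  then have z: "\<alpha> * \<delta> + \<beta> * \<gamma> = \<delta> * (a - \<beta> * (x * (a * c))) + \<beta> * c"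
    by (simp only: s)
  show ?thesis
    unfolding s t z a_def[symmetric] c_def[symmetric] by (simp add: algebra_simps)
qed

lemma mps_mult_left_cancel:
  fixes f g h :: "('v, 'a :: comm_ring_1) mps"
  assumes "mps_coeff f {#} = 1" and "f * g = f * h"
  shows "g = h"
proof -
  have "inverse f * (f * g) = inverse f * (f * h)"
    using assms(2) by simp
  then show ?thesis
    using mps_mult_inverse[OF assms(1)] by (simp add: mult.assoc[symmetric] mult.commute)
qed

text \<open>As \<open>S 0 = 0\<close>, the outer factors \<open>\<gamma>\<close> and
  \<open>\<alpha>\<close> are the values of \<open>\<gamma> - \<delta> * S k\<close> and
  \<open>\<alpha> + \<beta> * S k\<close> at \<open>k = 0\<close>. Each induction step cancels one
  factor \<open>\<gamma> - \<delta> * S k\<close>, which its constant term 1 permits over any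
  coefficient ring.\<close>

lemma moebius_telescope:
  fixes S x :: "nat \<Rightarrow> ('v, 'a :: comm_ring_1) mps"
  assumes step: "\<And>k. S (Suc k) - S k = x k * ((\<alpha> + \<beta> * S (Suc k)) * (\<gamma> - \<delta> * S k))"
    and "S 0 = 0"
    and unit: "\<And>k. mps_coeff (\<gamma> - \<delta> * S k) {#} = 1"
  shows "(\<alpha> + \<beta> * S k) * \<gamma> * (\<Prod>i<k. 1 - x i * (\<alpha> * \<delta> + \<beta> * \<gamma>)) = \<alpha> * (\<gamma> - \<delta> * S k)"
proof (induction k)
  case 0
  show ?case using assms(2) by simp
next
  case (Suc k)
  let ?a = "\<lambda>k. \<alpha> + \<beta> * S k" and ?c = "\<lambda>k. \<gamma> - \<delta> * S k"
  let ?q = "\<lambda>k. 1 - x k * (\<alpha> * \<delta> + \<beta> * \<gamma>)"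
  let ?Q = "\<lambda>k. \<Prod>i<k. ?q i"
  have "?c k * (?a (Suc k) * \<gamma> * ?Q (Suc k)) = ?a (Suc k) * ?q k * ?c k * \<gamma> * ?Q k"
    by (simp only: prod.lessThan_Suc ac_simps)
  also have "\<dots> = ?a k * \<gamma> * ?Q k * ?c (Suc k)"
    unfolding moebius_step[OF step] by (simp only: ac_simps)
  also have "\<dots> = ?c k * (\<alpha> * ?c (Suc k))"
    unfolding Suc.IH by (simp only: ac_simps)
  finally show ?case
    by (rule mps_mult_left_cancel[OF unit])
qed

theorem theorem1p1:
  shows "((1 + lam_bar * tree_gf) * (1 + rho_bar * tree_gf)) /
           ((1 + lam * tree_gf) * (1 + rho * tree_gf)) =
         complete_homogeneous_gf
           ((lam_bar * rho_bar - lam * rho) * tree_gf + lam_bar + rho_bar - lam - rho)"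
proof -
  let ?G = tree_gf
  define z where "z = (lam_bar * rho_bar - lam * rho) * ?G + lam_bar + rho_bar - lam - rho"
  let ?\<alpha> = "1 + lam * ?G" and ?\<beta> = "lam_bar - lam"
  let ?\<gamma> = "1 + rho_bar * ?G" and ?\<delta> = "rho_bar - rho"
  let ?H = "complete_homogeneous_gf z"
  let ?S = "\<lambda>k. root_gf {..k}"
  let ?Q = "\<lambda>k. \<Prod>i<k. 1 - mps_var (Suc i) * z"
  \<comment> \<open>The argument of \<open>H\<close> arises here, as the invariant of the
    recursion.\<close>
  have z: "?\<alpha> * ?\<delta> + ?\<beta> * ?\<gamma> = z"
    unfolding z_def by (simp add: algebra_simps)
  have step: "?S (Suc k) - ?S k =
      mps_var (Suc k) * ((?\<alpha> + ?\<beta> * ?S (Suc k)) * (?\<gamma> - ?\<delta> * ?S k))" for k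
  proof -
    have "?S (Suc k) = ?S k + root_gf {Suc k}"
      by (subst root_gf_Un[symmetric]) (auto intro: arg_cong[where f = root_gf])
    \<comment> \<open>Right descents from the root \<open>Suc k\<close> lead to labels at most
      \<open>k\<close>, so the right factor involves the previous \<open>?S k\<close>.\<close>
    moreover have "- {Suc k..} = {..k}" by auto
    then have "root_gf {Suc k..} = ?G - ?S k"
      using root_gf_Compl[of "{Suc k..}"] by (simp add: algebra_simps)
    ultimately show ?thesis
      using root_gf_singleton[of "Suc k"] \<open>- {Suc k..} = {..k}\<close>
      by (simp only: root_gf_Compl) (simp add: algebra_simps)
  qed
  \<comment> \<open>\<open>{..0}\<close> is not empty, but no tree has root label 0.\<close>
  have S0: "?S 0 = 0"
    by (rule mps_eq_if_cong, rule root_gf_cong_0) auto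
  have unit: "mps_coeff (?\<gamma> - ?\<delta> * ?S k) {#} = 1" for k
  proof -
    have "mps_cong {#} (1 + rho_bar * ?G - ?\<delta> * ?S k) (1 + rho_bar * 0 - ?\<delta> * 0)"
      unfolding tree_gf_eq_root_gf
      by (intro mps_cong_add mps_cong_diff mps_cong_mult mps_cong_refl root_gf_cong_0) simp_all
    then show ?thesis by (simp add: mps_cong_def one_mps.rep_eq)
  qed
  have telescope: "(?\<alpha> + ?\<beta> * ?S k) * ?\<gamma> * ?Q k = ?\<alpha> * (?\<gamma> - ?\<delta> * ?S k)" for k
    using moebius_telescope[of ?S "\<lambda>k. mps_var (Suc k)", OF step S0 unit] unfolding z by simp
  have "(1 + lam_bar * ?G) * (1 + rho_bar * ?G) = ?H * ((1 + lam * ?G) * (1 + rho * ?G))"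
  proof (rule mps_eq_if_cong)
    fix m :: "nat multiset"
    obtain k where k: "set_mset m \<subseteq> {..k}"
      using finite_nat_set_iff_bounded_le[of "set_mset m"] by auto
    have H: "mps_cong m (?H * ?Q k) 1"
      using k by (rule complete_homogeneous_gf_cong)
    have "mps_cong m (root_gf (- {..k})) 0"
      by (rule root_gf_cong_0) (use k in auto)
    then have "mps_cong m (?G - root_gf (- {..k})) (?G - 0)"
      by (intro mps_cong_diff mps_cong_refl)
    then have S: "mps_cong m (?S k) ?G"
      by (simp only: root_gf_Compl) simp
    \<comment> \<open>Replacing 1 by \<open>?H * ?Q k\<close> and \<open>?G\<close> by
      \<open>?S k\<close> makes the exact telescoped identity applicable; afterwards
      \<open>?S k\<close> is turned back into \<open>?G\<close>.\<close>
    have "mps_cong m (1 * ((?\<alpha> + ?\<beta> * ?G) * ?\<gamma>)) (?H * ?Q k * ((?\<alpha> + ?\<beta> * ?S k) * ?\<gamma>))"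
      by (intro mps_cong_mult mps_cong_add mps_cong_refl mps_cong_sym[OF S] mps_cong_sym[OF H])
    also have "?H * ?Q k * ((?\<alpha> + ?\<beta> * ?S k) * ?\<gamma>) = ?H * (?\<alpha> * (?\<gamma> - ?\<delta> * ?S k))"
      unfolding telescope[symmetric] by (simp only: ac_simps)
    also have "mps_cong m \<dots> (?H * (?\<alpha> * (?\<gamma> - ?\<delta> * ?G)))"
      by (intro mps_cong_mult mps_cong_diff mps_cong_refl S)
    finally show "mps_cong m ((1 + lam_bar * ?G) * (1 + rho_bar * ?G))
        (?H * ((1 + lam * ?G) * (1 + rho * ?G)))"
      by (simp add: algebra_simps)
  qed
  then have "((1 + lam_bar * ?G) * (1 + rho_bar * ?G)) / ((1 + lam * ?G) * (1 + rho * ?G)) =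
      ?H * (((1 + lam * ?G) * (1 + rho * ?G)) * inverse ((1 + lam * ?G) * (1 + rho * ?G)))"
    by (simp only: divide_mps_def mult.assoc)
  then show ?thesis
    by (simp only: denominator_inverse z_def mult_1_right)
qed

end
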